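(* \[ \sum_{k = 0}^\infty {\frac{1}{{\alpha ^{5k} }}\left( {\frac{{\beta }}{{5k + 1}} + \frac1{{5k + 2}} - \frac{{\beta}}{{5k + 3}} - \frac{\beta^4}{{5k + 4}} - \frac{2\beta^4}{{5k + 5}}} \right)} = 0. \]
   Context: $\alpha=(1+\sqrt5)/2$ is the golden ratio and $\beta=-1/\alpha=(1-\sqrt5)/2$. *)

theory Defs
  imports "HOL-Analysis.Analysis"
begin

definition golden_ratio :: real  (\<open>\<alpha>\<close>)
  where "\<alpha> = (1 + sqrt 5) / 2"

definition golden_conj :: real  (\<open>\<beta>\<close>)
  where "\<beta> = - 1 / \<alpha>"

lemma golden_conj_eq: "\<beta> = (1 - sqrt 5) / 2"
proof -
  have "1 + sqrt 5 > 0" by (simp add: add_pos_pos)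
  then have "1 + sqrt 5 \<noteq> 0" by linarith
  then show ?thesis
    by (simp add: golden_conj_def golden_ratio_def field_simps)
qed

end

(* Put x = 1 / \<alpha> = - \<beta> and z = x exp (2 pi i / 5). The numerator over 5 k + r is - 2 \<alpha> Re (z ^ r), and
   z ^ (5 k) = x ^ (5 k), so the series is a regrouping in blocks of five of
   - 2 \<alpha> Re (\<Sum>n\<ge>1. z ^ n / n) = 2 \<alpha> ln |1 - z|. Finally |1 - z| = 1 because 2 cos (2 pi / 5) = x. *)
theory Submission
  imports Defs
begin

text \<open>Real part of the Mercator series of \<open>Ln (1 - z)\<close>, since the real part of
  \<open>Ln\<close> is \<open>ln\<close> of the modulus.\<close>

lemma sums_Re_power_over_Suc:
  fixes z :: complex
  assumes "cmod z < 1"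
  shows "(\<lambda>n. Re (z ^ Suc n) / real (Suc n)) sums (- ln (cmod (1 - z)))"
proof -
  have "1 - z \<noteq> 0"
    using assms by auto
  have "(\<lambda>n. (- 1) ^ Suc n / of_nat n * (- z) ^ n) sums Ln (1 + - z)"
    using assms by (intro Ln_series) simp
  moreover have "(- 1) ^ Suc n / of_nat n * (- z) ^ n = - (z ^ n / of_nat n)" for n
    by (cases "even n") auto
  ultimately have "(\<lambda>n. - (z ^ n / of_nat n)) sums Ln (1 - z)"
    by (simp only: add_uminus_conv_diff)
  then have "(\<lambda>n. z ^ n / of_nat n) sums (- Ln (1 - z))"
    using sums_minus by fastforce
  then have "(\<lambda>n. Re (z ^ n / of_nat n)) sums Re (- Ln (1 - z))"
    by (rule sums_Re)
  then have "(\<lambda>n. Re (z ^ n) / real n) sums (- ln (cmod (1 - z)))"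
    using \<open>1 - z \<noteq> 0\<close> by (simp add: Re_divide_of_nat)
  \<comment> \<open>The index can be shifted at no cost: the term at n = 0 is a division by zero,
    hence 0.\<close>
  then show ?thesis
    by (subst sums_Suc_iff) simp
qed

text \<open>With these facts the later algebra is reduction modulo x^2 = 1 - x, and
  \<open>sqrt 5\<close> no longer appears.\<close>

lemma inverse_golden_ratio:
  fixes x :: real
  defines "x \<equiv> 1 / \<alpha>"
  shows "0 < x" "x < 1" "x\<^sup>2 = 1 - x" "\<alpha> = 1 + x" "\<beta> = - x"
proof -
  have x: "x = (sqrt 5 - 1) / 2"
    using golden_conj_eq by (simp add: x_def golden_conj_def field_simps)
  show "0 < x" "x < 1"
    by (simp_all add: x real_less_lsqrt)
  show "x\<^sup>2 = 1 - x"
    by (simp add: x power2_eq_square field_simps)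
  show "\<alpha> = 1 + x"
    by (simp add: x golden_ratio_def field_simps)
  show "\<beta> = - x"
    by (simp add: x_def golden_conj_def)
qed

theorem theorem5p8:
  shows "(\<lambda>k::nat. 1 / \<alpha> ^ (5 * k) *
            (\<beta> / (5 * real k + 1) + 1 / (5 * real k + 2) - \<beta> / (5 * real k + 3)
              - \<beta> ^ 4 / (5 * real k + 4) - 2 * \<beta> ^ 4 / (5 * real k + 5))) sums 0"
proof -
  define x where "x = 1 / \<alpha>"
  note x = inverse_golden_ratio[folded x_def]
  \<comment> \<open>The point x exp (2 pi i / 5), given by its coordinates to avoid evaluating cos (2 pi / 5).\<close>
  define z where "z = Complex (x\<^sup>2 / 2) (sqrt (x\<^sup>2 - (x\<^sup>2 / 2)\<^sup>2))"
  define X where "X = complex_of_real x"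
  have Re_z: "Re z = (1 - x) / 2"
    using x(3) by (simp add: z_def)
  \<comment> \<open>As x^2 = 1 - x, this makes the radicand in \<open>z\<close> nonnegative, so that
    squaring undoes the root.\<close>
  have "(1 - x)\<^sup>2 \<le> (1 - x) * 1"
    unfolding power2_eq_square using x(1,2) by (intro mult_left_mono) auto
  then have "(x\<^sup>2 / 2)\<^sup>2 \<le> x\<^sup>2"
    using x(1-3) by (simp add: power_divide)
  then have Im_z: "(Im z)\<^sup>2 = x\<^sup>2 - (x\<^sup>2 / 2)\<^sup>2"
    by (simp add: z_def)
  have norm_z: "cmod z = x"
    using x(1) Im_z by (simp add: cmod_def) (simp add: z_def)
  \<comment> \<open>|1 - z|^2 = 1 - 2 Re z + |z|^2, and both 2 Re z and |z|^2 equal 1 - x.\<close>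
  have norm_1z: "cmod (1 - z) = 1"
  proof -
    have "(1 - Re z)\<^sup>2 + (Im z)\<^sup>2 = 1"
      unfolding Im_z Re_z x(3) by (simp add: power2_eq_square field_simps)
    then show ?thesis
      by (simp add: cmod_def)
  qed

  have X: "X\<^sup>2 = 1 - X"
    unfolding X_def using x(3) by (metis of_real_1 of_real_diff of_real_power)
  \<comment> \<open>The real quadratic with roots z and its conjugate: trace 2 Re z and norm |z|^2
    are both 1 - x.\<close>
  have z2: "z\<^sup>2 = (1 - X) * z - (1 - X)"
  proof (rule complex_eqI)
    show "Re (z\<^sup>2) = Re ((1 - X) * z - (1 - X))"
    proof -
      have "4 * (Im z)\<^sup>2 = 4 * x\<^sup>2 - x ^ 4" "2 * Re z = 1 - x"
        using Im_z Re_z by (simp_all add: power_divide flip: power_mult)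
      then have "Re z * Re z - Im z * Im z = (1 - x) * Re z - (1 - x)"
        using x(3) by algebra
      then show ?thesis
        by (simp add: X_def power2_eq_square)
    qed
    show "Im (z\<^sup>2) = Im ((1 - X) * z - (1 - X))"
      by (simp add: X_def Re_z power2_eq_square)
  qed
  \<comment> \<open>The two quadratic relations reduce each power to degree at most one in z and in
    X. In the fifth power the coefficient of z vanishes.\<close>
  have z3: "z ^ 3 = (1 - 2 * X) * z - (2 - 3 * X)"
    using X z2 by algebra
  have z4: "z ^ 4 = (1 - 2 * X) * z - (3 - 5 * X)"
    using X z2 by algebra
  have z5: "z ^ 5 = X ^ 5"
    using X z2 by algebra
  have x4: "x ^ 4 = 2 - 3 * x" and x5: "x ^ 5 = 5 * x - 3"
    using x(3) by algebra+
  \<comment> \<open>The second form lets the simplifier reduce x^2 inside right-nested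
    products.\<close>
  have xx: "x * x = 1 - x" "x * (x * c) = (1 - x) * c" for c
    using x(3) by (simp_all add: power2_eq_square flip: mult.assoc)
  have coeffs: "- 2 * \<alpha> * Re z = \<beta>" "- 2 * \<alpha> * Re (z\<^sup>2) = 1" "- 2 * \<alpha> * Re (z ^ 3) = - \<beta>"
    "- 2 * \<alpha> * Re (z ^ 4) = - (\<beta> ^ 4)" "- 2 * \<alpha> * Re (z ^ 5) = - 2 * \<beta> ^ 4"
    unfolding z2 z3 z4 z5 x(4,5)
    by (simp_all add: X_def Re_z x4 x5 field_simps xx flip: of_real_power)

  have Re_power: "Re (z ^ (5 * k + r)) = x ^ (5 * k) * Re (z ^ r)" for k r
    by (simp add: power_add power_mult z5 X_def flip: of_real_power)
  have "(\<lambda>n. Re (z ^ Suc n) / real (Suc n)) sums 0"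
    using sums_Re_power_over_Suc[of z] norm_z norm_1z x(2) by simp
  \<comment> \<open>Grouping consecutive terms only passes to a subsequence of the partial sums.
    Because of \<open>Suc\<close>, block k holds the exponents 5 k + 1 to 5 k + 5.\<close>
  then have "(\<lambda>k. \<Sum>n = k * 5..<k * 5 + 5. Re (z ^ Suc n) / real (Suc n)) sums 0"
    by (rule sums_group) simp
  then have "(\<lambda>k. - 2 * \<alpha> * (\<Sum>n = k * 5..<k * 5 + 5. Re (z ^ Suc n) / real (Suc n))) sums 0"
    using sums_mult[of _ 0 "- 2 * \<alpha>"] by simp
  moreover have "- 2 * \<alpha> * (\<Sum>n = k * 5..<k * 5 + 5. Re (z ^ Suc n) / real (Suc n)) =
      1 / \<alpha> ^ (5 * k) *
            (\<beta> / (5 * real k + 1) + 1 / (5 * real k + 2) - \<beta> / (5 * real k + 3)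
              - \<beta> ^ 4 / (5 * real k + 4) - 2 * \<beta> ^ 4 / (5 * real k + 5))" for k
  proof -
    have "(\<Sum>n = k * 5..<k * 5 + 5. Re (z ^ Suc n) / real (Suc n)) =
        (\<Sum>r<5. Re (z ^ (5 * k + Suc r)) / real (5 * k + Suc r))"
      using sum.shift_bounds_nat_ivl[of "\<lambda>n. Re (z ^ Suc n) / real (Suc n)" 0 "k * 5" 5]
      by (simp add: atLeast0LessThan algebra_simps)
    also have "\<dots> = x ^ (5 * k) * (\<Sum>r<5. Re (z ^ Suc r) / (5 * real k + real (Suc r)))"
      unfolding Re_power by (simp add: sum_distrib_left add_ac del: power_Suc)
    also have "(\<Sum>r<5. Re (z ^ Suc r) / (5 * real k + real (Suc r))) =
        Re z / (5 * real k + 1) + Re (z\<^sup>2) / (5 * real k + 2) + Re (z ^ 3) / (5 * real k + 3)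
          + Re (z ^ 4) / (5 * real k + 4) + Re (z ^ 5) / (5 * real k + 5)"
      by (simp add: lessThan_Suc eval_nat_numeral algebra_simps)
    \<comment> \<open>The constant is moved into every numerator so that the left-hand sides of
      \<open>coeffs\<close> occur literally.\<close>
    finally have "- 2 * \<alpha> * (\<Sum>n = k * 5..<k * 5 + 5. Re (z ^ Suc n) / real (Suc n)) =
        x ^ (5 * k) * ((- 2 * \<alpha> * Re z) / (5 * real k + 1) + (- 2 * \<alpha> * Re (z\<^sup>2)) / (5 * real k + 2)
          + (- 2 * \<alpha> * Re (z ^ 3)) / (5 * real k + 3) + (- 2 * \<alpha> * Re (z ^ 4)) / (5 * real k + 4)
          + (- 2 * \<alpha> * Re (z ^ 5)) / (5 * real k + 5))"
      by (simp only: distrib_left times_divide_eq_right mult.assoc mult.left_commute)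
    then show ?thesis
      unfolding coeffs by (simp add: x_def power_one_over)
  qed
  ultimately show ?thesis
    by simp
qed

end
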